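(* There exists a functor $F\colon{\sf 1C}\to{\sf HBrcd}$ from the category of 1-cocycles in ${\sf C}$ to the category of Hopf bracoids in ${\sf C}$, defined on objects by sending a 1-cocycle $\pi\colon H\to B$ (with left $H$-module algebra structure $\gamma_B$ on $B$) to $(H,B,\psi_{B})$, where $\psi_{B}= \mu_{B}\circ(\pi\otimes\gamma_{B})\circ(\delta_{H}\otimes B)$, and on morphisms by the identity, i.e. $F((f,g))=(f,g)$.
   Context: ${\sf C}$ is a strict braided monoidal category with tensor product $\otimes$, unit object $K$ and braiding $c$. For an object $P$ and a morphism $f$, write $P\otimes f$ for $id_P\otimes f$ and $f\otimes P$ for $f\otimes id_P$. Algebras $(A,\eta_A,\mu_A)$, coalgebras $(D,\varepsilon_D,\delta_D)$, and Hopf algebras $X=(X,\eta_X,\mu_X,\varepsilon_X,\delta_X,\lambda_X)$ (with antipode $\lambda_X$) are taken in ${\sf C}$; tensor products have structures $\mu_{A\otimes B}=(\mu_A\otimes\mu_B)\circ(A\otimes c_{B,A}\otimes B)$ and $\delta_{D\otimes E}=(D\otimes c_{D,E}\otimes E)\circ(\delta_D\otimes\delta_E)$, with the obvious units and counits. A morphism of Hopf algebras is a morphism that is both an algebra and a coalgebra morphism. A Hopf bracoid in ${\sf C}$ is a triple $(H,B,\varphi_B)$ where $H,B$ are Hopf algebras in ${\sf C}$ and $(B,\varphi_B)$ is a left $H$-module such that $$\varphi_{B}\circ(H\otimes\mu_{B})=\mu_{B}\circ (\varphi_{B}\otimes\Phi_{B})\circ(H\otimes c_{H,B}\otimes B)\circ(\delta_{H}\otimes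 B\otimes B),$$ where $\Phi_{B}= \mu_{B}\circ((\lambda_{B}\circ u_{\varphi_{B}})\otimes\varphi_{B})\circ(\delta_{H}\otimes B)$ and $u_{\varphi_{B}}=\varphi_{B}\circ(H\otimes\eta_{B})$. A morphism of Hopf bracoids $(H,B,\varphi_B)\to(H',B',\varphi_{B'})$ is a pair $(f,g)$ of Hopf algebra morphisms $f\colon H\to H'$, $g\colon B\to B'$ with $g\circ\varphi_B=\varphi_{B'}\circ(f\otimes g)$. These form the category ${\sf HBrcd}$. For a Hopf algebra $X$, an algebra $A$ with a left $X$-module structure $\varphi_A$ is a left $X$-module algebra if $\varphi_A\circ(X\otimes\eta_A)=\varepsilon_X\otimes\eta_A$ and $\varphi_A\circ(X\otimes\mu_A)=\mu_A\circ(\varphi_A\otimes\varphi_A)\circ(X\otimes c_{X,A}\otimes A)\circ(\delta_X\otimes A\otimes A)$. A 1-cocycle in ${\sf C}$ consists of Hopf algebras $H,B$ in ${\sf C}$, a left $H$-module algebra structure $(B,\gamma_B)$, and a coalgebra morphism $\pi\colon H\to B$ such that $\mu_{B}\circ(\pi\otimes\gamma_{B})\circ(\delta_{H}\otimes\pi)=\pi\circ\mu_{H}$. A morphism of 1-cocycles from $\pi\colon H\to B$ to $\tau\colon H'\to B'$ is a pair $(f,g)$ of Hopf algebra morphisms $f\colon H\to H'$, $g\colon B\to B'$ with $\tau\circ f=g\circ\pi$ and $g\circ\gamma_B=\gamma_{B'}\circ(f\otimes g)$. These form the category ${\sf 1C}$. *)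

theory Defs
  imports Main
begin

record ('o, 'm) category =
  Ob :: "'o set"
  Ar :: "'m set"
  Dom :: "'m \<Rightarrow> 'o"
  Cod :: "'m \<Rightarrow> 'o"
  Id :: "'o \<Rightarrow> 'm"  ("\<one>\<index>")
  Comp :: "'m \<Rightarrow> 'm \<Rightarrow> 'm"  (infixr "\<cdot>\<index>" 55)

definition Hom :: "('o, 'm, 'z) category_scheme \<Rightarrow> 'o \<Rightarrow> 'o \<Rightarrow> 'm set" where
  "Hom C A B = {f \<in> Ar C. Dom C f = A \<and> Cod C f = B}"

text \<open>Only composites with matching codomain and domain are constrained.\<close>

locale category =
  fixes C :: "('o, 'm, 'z) category_scheme" (structure)
  assumes Dom_Ob: "f \<in> Ar C \<Longrightarrow> Dom C f \<in> Ob C"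
    and Cod_Ob: "f \<in> Ar C \<Longrightarrow> Cod C f \<in> Ob C"
    and Id_Hom: "A \<in> Ob C \<Longrightarrow> \<one> A \<in> Hom C A A"
    and Comp_Hom: "f \<in> Hom C A B \<Longrightarrow> g \<in> Hom C B D \<Longrightarrow> g \<cdot> f \<in> Hom C A D"
    and Id_left: "f \<in> Hom C A B \<Longrightarrow> \<one> B \<cdot> f = f"
    and Id_right: "f \<in> Hom C A B \<Longrightarrow> f \<cdot> \<one> A = f"
    and Comp_assoc: "f \<in> Hom C A B \<Longrightarrow> g \<in> Hom C B D \<Longrightarrow> h \<in> Hom C D E
          \<Longrightarrow> (h \<cdot> g) \<cdot> f = h \<cdot> (g \<cdot> f)"

locale cat_functor = S: category S + T: category T
  for S :: "('o, 'm, 'z) category_scheme" and T :: "('p, 'n, 'y) category_scheme" +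
  fixes Fo :: "'o \<Rightarrow> 'p" and Fa :: "'m \<Rightarrow> 'n"
  assumes Fo_Ob: "A \<in> Ob S \<Longrightarrow> Fo A \<in> Ob T"
    and Fa_Hom: "f \<in> Hom S A B \<Longrightarrow> Fa f \<in> Hom T (Fo A) (Fo B)"
    and Fa_Id: "A \<in> Ob S \<Longrightarrow> Fa (Id S A) = Id T (Fo A)"
    and Fa_Comp: "f \<in> Hom S A B \<Longrightarrow> g \<in> Hom S B D
          \<Longrightarrow> Fa (Comp S g f) = Comp T (Fa g) (Fa f)"

record ('o, 'm) braided_category = "('o, 'm) category" +
  TensO :: "'o \<Rightarrow> 'o \<Rightarrow> 'o"  (infixr "\<boxtimes>\<index>" 70)
  TensA :: "'m \<Rightarrow> 'm \<Rightarrow> 'm"  (infixr "\<otimes>\<index>" 70)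
  UnitO :: "'o"  ("\<K>\<index>")
  Braid :: "'o \<Rightarrow> 'o \<Rightarrow> 'm"  ("\<c>\<index>")

text \<open>The identities \<open>\<c> A \<K> = \<one> A = \<c> \<K> A\<close> follow from the hexagon identities and the
  invertibility of the braiding.\<close>

locale strict_braided_monoidal_category = category C
  for C :: "('o, 'm, 'z) braided_category_scheme" (structure) +
  assumes UnitO_Ob: "\<K> \<in> Ob C"
    and TensO_Ob: "A \<in> Ob C \<Longrightarrow> B \<in> Ob C \<Longrightarrow> A \<boxtimes> B \<in> Ob C"
    and TensA_Hom: "f \<in> Hom C A A' \<Longrightarrow> g \<in> Hom C B B' \<Longrightarrow> f \<otimes> g \<in> Hom C (A \<boxtimes> B) (A' \<boxtimes> B')"
    and TensA_Id: "A \<in> Ob C \<Longrightarrow> B \<in> Ob C \<Longrightarrow> \<one> A \<otimes> \<one> B = \<one> (A \<boxtimes> B)"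
    and TensA_Comp: "f \<in> Hom C A A' \<Longrightarrow> f' \<in> Hom C A' A'' \<Longrightarrow> g \<in> Hom C B B' \<Longrightarrow> g' \<in> Hom C B' B''
          \<Longrightarrow> (f' \<cdot> f) \<otimes> (g' \<cdot> g) = (f' \<otimes> g') \<cdot> (f \<otimes> g)"
    and TensO_assoc: "A \<in> Ob C \<Longrightarrow> B \<in> Ob C \<Longrightarrow> D \<in> Ob C \<Longrightarrow> (A \<boxtimes> B) \<boxtimes> D = A \<boxtimes> (B \<boxtimes> D)"
    and TensA_assoc: "f \<in> Ar C \<Longrightarrow> g \<in> Ar C \<Longrightarrow> h \<in> Ar C \<Longrightarrow> (f \<otimes> g) \<otimes> h = f \<otimes> (g \<otimes> h)"
    and TensO_unit_left: "A \<in> Ob C \<Longrightarrow> \<K> \<boxtimes> A = A"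
    and TensO_unit_right: "A \<in> Ob C \<Longrightarrow> A \<boxtimes> \<K> = A"
    and TensA_unit_left: "f \<in> Ar C \<Longrightarrow> \<one> \<K> \<otimes> f = f"
    and TensA_unit_right: "f \<in> Ar C \<Longrightarrow> f \<otimes> \<one> \<K> = f"
    and Braid_Hom: "A \<in> Ob C \<Longrightarrow> B \<in> Ob C \<Longrightarrow> \<c> A B \<in> Hom C (A \<boxtimes> B) (B \<boxtimes> A)"
    and Braid_iso: "A \<in> Ob C \<Longrightarrow> B \<in> Ob C \<Longrightarrow>
          \<exists>d \<in> Hom C (B \<boxtimes> A) (A \<boxtimes> B). d \<cdot> \<c> A B = \<one> (A \<boxtimes> B) \<and> \<c> A B \<cdot> d = \<one> (B \<boxtimes> A)"
    and Braid_natural: "f \<in> Hom C A A' \<Longrightarrow> g \<in> Hom C B B'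
          \<Longrightarrow> \<c> A' B' \<cdot> (f \<otimes> g) = (g \<otimes> f) \<cdot> \<c> A B"
    and hexagon_right: "A \<in> Ob C \<Longrightarrow> B \<in> Ob C \<Longrightarrow> D \<in> Ob C
          \<Longrightarrow> \<c> A (B \<boxtimes> D) = (\<one> B \<otimes> \<c> A D) \<cdot> (\<c> A B \<otimes> \<one> D)"
    and hexagon_left: "A \<in> Ob C \<Longrightarrow> B \<in> Ob C \<Longrightarrow> D \<in> Ob C
          \<Longrightarrow> \<c> (A \<boxtimes> B) D = (\<c> A D \<otimes> \<one> B) \<cdot> (\<one> A \<otimes> \<c> B D)"

record ('o, 'm) hopf =
  car :: "'o"
  unit :: "'m"
  mult :: "'m"
  counit :: "'m"
  comult :: "'m"
  antipode :: "'m"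

text \<open>Algebras are triples (object, unit, product), coalgebras are triples
  (object, counit, coproduct).\<close>

definition alg_of :: "('o, 'm) hopf \<Rightarrow> 'o \<times> 'm \<times> 'm" where
  "alg_of X = (car X, unit X, mult X)"

definition coalg_of :: "('o, 'm) hopf \<Rightarrow> 'o \<times> 'm \<times> 'm" where
  "coalg_of X = (car X, counit X, comult X)"

context
  fixes C :: "('o, 'm, 'z) braided_category_scheme" (structure)
begin

fun algebra :: "'o \<times> 'm \<times> 'm \<Rightarrow> bool" where
  "algebra (A, \<eta>, \<mu>) \<longleftrightarrow>
     A \<in> Ob C \<and> \<eta> \<in> Hom C \<K> A \<and> \<mu> \<in> Hom C (A \<boxtimes> A) A \<and>
     \<mu> \<cdot> (\<one> A \<otimes> \<eta>) = \<one> A \<and> \<mu> \<cdot> (\<eta> \<otimes> \<one> A) = \<one> A \<and>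
     \<mu> \<cdot> (\<one> A \<otimes> \<mu>) = \<mu> \<cdot> (\<mu> \<otimes> \<one> A)"

fun algebra_morphism :: "'o \<times> 'm \<times> 'm \<Rightarrow> 'o \<times> 'm \<times> 'm \<Rightarrow> 'm \<Rightarrow> bool" where
  "algebra_morphism (A, \<eta>\<^sub>A, \<mu>\<^sub>A) (B, \<eta>\<^sub>B, \<mu>\<^sub>B) f \<longleftrightarrow>
     f \<in> Hom C A B \<and> f \<cdot> \<eta>\<^sub>A = \<eta>\<^sub>B \<and> \<mu>\<^sub>B \<cdot> (f \<otimes> f) = f \<cdot> \<mu>\<^sub>A"

fun coalgebra :: "'o \<times> 'm \<times> 'm \<Rightarrow> bool" where
  "coalgebra (D, \<epsilon>, \<delta>) \<longleftrightarrow>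
     D \<in> Ob C \<and> \<epsilon> \<in> Hom C D \<K> \<and> \<delta> \<in> Hom C D (D \<boxtimes> D) \<and>
     (\<epsilon> \<otimes> \<one> D) \<cdot> \<delta> = \<one> D \<and> (\<one> D \<otimes> \<epsilon>) \<cdot> \<delta> = \<one> D \<and>
     (\<delta> \<otimes> \<one> D) \<cdot> \<delta> = (\<one> D \<otimes> \<delta>) \<cdot> \<delta>"

fun coalgebra_morphism :: "'o \<times> 'm \<times> 'm \<Rightarrow> 'o \<times> 'm \<times> 'm \<Rightarrow> 'm \<Rightarrow> bool" where
  "coalgebra_morphism (D, \<epsilon>\<^sub>D, \<delta>\<^sub>D) (E, \<epsilon>\<^sub>E, \<delta>\<^sub>E) f \<longleftrightarrow>
     f \<in> Hom C D E \<and> \<epsilon>\<^sub>E \<cdot> f = \<epsilon>\<^sub>D \<and> (f \<otimes> f) \<cdot> \<delta>\<^sub>D = \<delta>\<^sub>E \<cdot> f"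

definition unit_algebra :: "'o \<times> 'm \<times> 'm" where
  "unit_algebra = (\<K>, \<one> \<K>, \<one> \<K>)"

fun tensor_algebra :: "'o \<times> 'm \<times> 'm \<Rightarrow> 'o \<times> 'm \<times> 'm \<Rightarrow> 'o \<times> 'm \<times> 'm" where
  "tensor_algebra (A, \<eta>\<^sub>A, \<mu>\<^sub>A) (B, \<eta>\<^sub>B, \<mu>\<^sub>B) =
     (A \<boxtimes> B, \<eta>\<^sub>A \<otimes> \<eta>\<^sub>B, (\<mu>\<^sub>A \<otimes> \<mu>\<^sub>B) \<cdot> (\<one> A \<otimes> \<c> B A \<otimes> \<one> B))"

definition hopf_algebra :: "('o, 'm) hopf \<Rightarrow> bool" where
  "hopf_algebra X \<longleftrightarrow>
     algebra (alg_of X) \<and> coalgebra (coalg_of X) \<and>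
     algebra_morphism (alg_of X) unit_algebra (counit X) \<and>
     algebra_morphism (alg_of X) (tensor_algebra (alg_of X) (alg_of X)) (comult X) \<and>
     antipode X \<in> Hom C (car X) (car X) \<and>
     mult X \<cdot> (\<one> (car X) \<otimes> antipode X) \<cdot> comult X = unit X \<cdot> counit X \<and>
     mult X \<cdot> (antipode X \<otimes> \<one> (car X)) \<cdot> comult X = unit X \<cdot> counit X"

definition hopf_morphism :: "('o, 'm) hopf \<Rightarrow> ('o, 'm) hopf \<Rightarrow> 'm \<Rightarrow> bool" where
  "hopf_morphism X Y f \<longleftrightarrow>
     algebra_morphism (alg_of X) (alg_of Y) f \<and> coalgebra_morphism (coalg_of X) (coalg_of Y) f"

definition left_module :: "('o, 'm) hopf \<Rightarrow> 'o \<Rightarrow> 'm \<Rightarrow> bool" where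
  "left_module X M \<phi> \<longleftrightarrow>
     M \<in> Ob C \<and> \<phi> \<in> Hom C (car X \<boxtimes> M) M \<and>
     \<phi> \<cdot> (unit X \<otimes> \<one> M) = \<one> M \<and>
     \<phi> \<cdot> (\<one> (car X) \<otimes> \<phi>) = \<phi> \<cdot> (mult X \<otimes> \<one> M)"

fun left_module_algebra :: "('o, 'm) hopf \<Rightarrow> 'o \<times> 'm \<times> 'm \<Rightarrow> 'm \<Rightarrow> bool" where
  "left_module_algebra X (A, \<eta>, \<mu>) \<phi> \<longleftrightarrow>
     algebra (A, \<eta>, \<mu>) \<and> left_module X A \<phi> \<and>
     \<phi> \<cdot> (\<one> (car X) \<otimes> \<eta>) = counit X \<otimes> \<eta> \<and>
     \<phi> \<cdot> (\<one> (car X) \<otimes> \<mu>) =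
       \<mu> \<cdot> (\<phi> \<otimes> \<phi>) \<cdot> (\<one> (car X) \<otimes> \<c> (car X) A \<otimes> \<one> A) \<cdot> (comult X \<otimes> \<one> A \<otimes> \<one> A)"

definition u_map :: "('o, 'm) hopf \<Rightarrow> ('o, 'm) hopf \<Rightarrow> 'm \<Rightarrow> 'm" where
  "u_map H B \<phi> = \<phi> \<cdot> (\<one> (car H) \<otimes> unit B)"

definition Phi_map :: "('o, 'm) hopf \<Rightarrow> ('o, 'm) hopf \<Rightarrow> 'm \<Rightarrow> 'm" where
  "Phi_map H B \<phi> =
     mult B \<cdot> ((antipode B \<cdot> u_map H B \<phi>) \<otimes> \<phi>) \<cdot> (comult H \<otimes> \<one> (car B))"

fun hopf_bracoid :: "('o, 'm) hopf \<times> ('o, 'm) hopf \<times> 'm \<Rightarrow> bool" where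
  "hopf_bracoid (H, B, \<phi>) \<longleftrightarrow>
     hopf_algebra H \<and> hopf_algebra B \<and> left_module H (car B) \<phi> \<and>
     \<phi> \<cdot> (\<one> (car H) \<otimes> mult B) =
       mult B \<cdot> (\<phi> \<otimes> Phi_map H B \<phi>) \<cdot> (\<one> (car H) \<otimes> \<c> (car H) (car B) \<otimes> \<one> (car B))
         \<cdot> (comult H \<otimes> \<one> (car B) \<otimes> \<one> (car B))"

fun hopf_bracoid_morphism ::
  "('o, 'm) hopf \<times> ('o, 'm) hopf \<times> 'm \<Rightarrow> ('o, 'm) hopf \<times> ('o, 'm) hopf \<times> 'm \<Rightarrow> 'm \<times> 'm \<Rightarrow> bool"
where
  "hopf_bracoid_morphism (H, B, \<phi>) (H', B', \<phi>') (f, g) \<longleftrightarrow>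
     hopf_morphism H H' f \<and> hopf_morphism B B' g \<and> g \<cdot> \<phi> = \<phi>' \<cdot> (f \<otimes> g)"

text \<open>An arrow of the category is a pair \<open>(f, g)\<close> tagged with its source and its target.\<close>

definition HBrcd ::
  "(('o, 'm) hopf \<times> ('o, 'm) hopf \<times> 'm,
    (('o, 'm) hopf \<times> ('o, 'm) hopf \<times> 'm) \<times> ('m \<times> 'm) \<times> (('o, 'm) hopf \<times> ('o, 'm) hopf \<times> 'm))
   category"
where
  "HBrcd = \<lparr>
     Ob = {X. hopf_bracoid X},
     Ar = {(X, p, Y). hopf_bracoid X \<and> hopf_bracoid Y \<and> hopf_bracoid_morphism X Y p},
     Dom = (\<lambda>(X, p, Y). X),
     Cod = (\<lambda>(X, p, Y). Y),
     Id = (\<lambda>(H, B, \<phi>). ((H, B, \<phi>), (\<one> (car H), \<one> (car B)), (H, B, \<phi>))),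
     Comp = (\<lambda>(Y', (f', g'), Z) (X, (f, g), Y). (X, (f' \<cdot> f, g' \<cdot> g), Z)) \<rparr>"

text \<open>A 1-cocycle \<open>\<pi> : H \<rightarrow> B\<close> for the module algebra structure \<open>\<gamma>\<close> is encoded as
  \<open>(H, B, \<gamma>, \<pi>)\<close>.\<close>

fun one_cocycle :: "('o, 'm) hopf \<times> ('o, 'm) hopf \<times> 'm \<times> 'm \<Rightarrow> bool" where
  "one_cocycle (H, B, \<gamma>, \<pi>) \<longleftrightarrow>
     hopf_algebra H \<and> hopf_algebra B \<and> left_module_algebra H (alg_of B) \<gamma> \<and>
     coalgebra_morphism (coalg_of H) (coalg_of B) \<pi> \<and>
     mult B \<cdot> (\<pi> \<otimes> \<gamma>) \<cdot> (comult H \<otimes> \<pi>) = \<pi> \<cdot> mult H"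

fun one_cocycle_morphism ::
  "('o, 'm) hopf \<times> ('o, 'm) hopf \<times> 'm \<times> 'm \<Rightarrow> ('o, 'm) hopf \<times> ('o, 'm) hopf \<times> 'm \<times> 'm
    \<Rightarrow> 'm \<times> 'm \<Rightarrow> bool"
where
  "one_cocycle_morphism (H, B, \<gamma>, \<pi>) (H', B', \<gamma>', \<tau>) (f, g) \<longleftrightarrow>
     hopf_morphism H H' f \<and> hopf_morphism B B' g \<and>
     \<tau> \<cdot> f = g \<cdot> \<pi> \<and> g \<cdot> \<gamma> = \<gamma>' \<cdot> (f \<otimes> g)"

definition OneC ::
  "(('o, 'm) hopf \<times> ('o, 'm) hopf \<times> 'm \<times> 'm,
    (('o, 'm) hopf \<times> ('o, 'm) hopf \<times> 'm \<times> 'm) \<times> ('m \<times> 'm)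
      \<times> (('o, 'm) hopf \<times> ('o, 'm) hopf \<times> 'm \<times> 'm)) category"
where
  "OneC = \<lparr>
     Ob = {X. one_cocycle X},
     Ar = {(X, p, Y). one_cocycle X \<and> one_cocycle Y \<and> one_cocycle_morphism X Y p},
     Dom = (\<lambda>(X, p, Y). X),
     Cod = (\<lambda>(X, p, Y). Y),
     Id = (\<lambda>(H, B, \<gamma>, \<pi>). ((H, B, \<gamma>, \<pi>), (\<one> (car H), \<one> (car B)), (H, B, \<gamma>, \<pi>))),
     Comp = (\<lambda>(Y', (f', g'), Z) (X, (f, g), Y). (X, (f' \<cdot> f, g' \<cdot> g), Z)) \<rparr>"

end

end

theory Submission
  imports Defs
begin

text \<open>Evaluating the cocycle identity on units shows that \<open>\<pi> \<cdot> \<eta>\<^sub>H\<close> is idempotent; being grouplike, it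
  is convolution invertible, hence equals \<open>\<eta>\<^sub>B\<close>. For the convolution
  \<open>\<psi> = \<pi> * \<gamma>\<close> one finds \<open>u\<^sub>\<psi> = \<pi>\<close>, so
  \<open>\<Phi> = (\<lambda>\<^sub>B \<cdot> \<pi>) * (\<pi> * \<gamma>) = \<gamma>\<close> and the bracoid axiom becomes the compatibility of \<open>\<gamma>\<close> with
  the product of \<open>B\<close>. Applied to \<open>\<psi> \<cdot> (H \<otimes> (\<pi> * \<gamma>))\<close>, this axiom and \<open>\<psi> \<cdot> (H \<otimes> \<pi>) = \<pi> \<cdot> \<mu>\<^sub>H\<close>
  (the cocycle identity) give the associativity of \<open>\<psi>\<close>.\<close>

section \<open>Arrow typing and rewriting in a category\<close>

context category
begin

lemma HomD:
  assumes "f \<in> Hom C A B"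
  shows "f \<in> Ar C" "Dom C f = A" "Cod C f = B"
  using assms by (auto simp: Hom_def)

lemma Id_typing [simp]:
  assumes "A \<in> Ob C"
  shows "\<one> A \<in> Ar C" "Dom C (\<one> A) = A" "Cod C (\<one> A) = A"
  using HomD[OF Id_Hom[OF assms]] .

text \<open>Phrased with \<open>Dom\<close> and \<open>Cod\<close> instead of \<open>Hom\<close>,
  the category axioms have side conditions that simplification computes from the arrows, with no
  intermediate objects to guess.\<close>

lemma Comp_typing [simp]:
  assumes "f \<in> Ar C" "g \<in> Ar C" "Cod C f = Dom C g"
  shows "g \<cdot> f \<in> Ar C" "Dom C (g \<cdot> f) = Dom C f" "Cod C (g \<cdot> f) = Cod C g"
  using Comp_Hom[of f "Dom C f" "Cod C f" g "Cod C g"] assms by (auto simp: Hom_def)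

lemma Comp_assoc_Ar [simp]:
  assumes "f \<in> Ar C" "g \<in> Ar C" "h \<in> Ar C" "Cod C f = Dom C g" "Cod C g = Dom C h"
  shows "(h \<cdot> g) \<cdot> f = h \<cdot> (g \<cdot> f)"
  using Comp_assoc[of f "Dom C f" "Cod C f" g "Cod C g" h "Cod C h"] assms by (auto simp: Hom_def)

lemma Id_left_Ar [simp]: "f \<in> Ar C \<Longrightarrow> Cod C f = A \<Longrightarrow> \<one> A \<cdot> f = f"
  using Id_left by (auto simp: Hom_def)

lemma Id_right_Ar [simp]: "f \<in> Ar C \<Longrightarrow> Dom C f = A \<Longrightarrow> f \<cdot> \<one> A = f"
  using Id_right by (auto simp: Hom_def)

declare Dom_Ob [simp] Cod_Ob [simp]

text \<open>Normal forms nest composites to the right, so a law for \<open>g \<cdot> f\<close> no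
  longer matches once another arrow \<open>x\<close> precedes it. This form of the law does.\<close>

lemma Comp_reassoc:
  assumes "g \<cdot> f = k" "x \<in> Ar C" "f \<in> Ar C" "g \<in> Ar C" "Cod C x = Dom C f" "Cod C f = Dom C g"
  shows "g \<cdot> f \<cdot> x = k \<cdot> x"
  using assms by (simp flip: Comp_assoc_Ar)

end

section \<open>Layer calculus for the strict tensor product\<close>

context strict_braided_monoidal_category
begin

declare UnitO_Ob [simp] TensO_Ob [simp] TensO_assoc [simp] TensO_unit_left [simp]
  TensO_unit_right [simp] TensA_assoc [simp] TensA_unit_left [simp] TensA_unit_right [simp]

lemma TensA_typing [simp]:
  assumes "f \<in> Ar C" "g \<in> Ar C"
  shows "f \<otimes> g \<in> Ar C" "Dom C (f \<otimes> g) = Dom C f \<boxtimes> Dom C g"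
    "Cod C (f \<otimes> g) = Cod C f \<boxtimes> Cod C g"
  using TensA_Hom[of f "Dom C f" "Cod C f" g "Dom C g" "Cod C g"] assms by (auto simp: Hom_def)

lemma Braid_typing [simp]:
  assumes "A \<in> Ob C" "B \<in> Ob C"
  shows "\<c> A B \<in> Ar C" "Dom C (\<c> A B) = A \<boxtimes> B" "Cod C (\<c> A B) = B \<boxtimes> A"
  using Braid_Hom[OF assms] by (auto simp: Hom_def)

text \<open>Bifunctoriality is oriented so that two layers of a string diagram fuse into one.
  Splitting a layer is then proved by fusing the right-hand side.\<close>

lemma interchange:
  assumes "f \<in> Ar C" "f' \<in> Ar C" "g \<in> Ar C" "g' \<in> Ar C" "Cod C f = Dom C f'" "Cod C g = Dom C g'"
  shows "(f' \<otimes> g') \<cdot> (f \<otimes> g) = (f' \<cdot> f) \<otimes> (g' \<cdot> g)"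
  using TensA_Comp[of f "Dom C f" "Cod C f" f' "Cod C f'" g "Dom C g" "Cod C g" g' "Cod C g'"] assms
  by (auto simp: Hom_def)

lemma interchange_Comp:
  assumes "f \<in> Ar C" "f' \<in> Ar C" "g \<in> Ar C" "g' \<in> Ar C" "Cod C f = Dom C f'" "Cod C g = Dom C g'"
    "k \<in> Ar C" "Cod C k = Dom C f \<boxtimes> Dom C g"
  shows "(f' \<otimes> g') \<cdot> (f \<otimes> g) \<cdot> k = ((f' \<cdot> f) \<otimes> (g' \<cdot> g)) \<cdot> k"
  using assms by (simp flip: Comp_assoc_Ar add: interchange)

text \<open>Merging neighbouring identity strands complements the right-nested normal form. Some
  later steps delete this rule or \<open>TensA_assoc\<close>, because \<open>interchange\<close>
  must see a factor boundary that normalisation would hide.\<close>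

lemma Id_TensA_Id_TensA [simp]:
  assumes "A \<in> Ob C" "B \<in> Ob C" "f \<in> Ar C"
  shows "\<one> A \<otimes> \<one> B \<otimes> f = \<one> (A \<boxtimes> B) \<otimes> f"
  using TensA_assoc[of "\<one> A" "\<one> B" f] assms by (simp add: TensA_Id del: TensA_assoc)

lemmas contract = interchange interchange_Comp TensA_Id

text \<open>Arrows on disjoint strands slide past each other. When one end is \<open>\<K>\<close>,
  strictness removes an identity strand and the tensor becomes a composite, which is how units and
  counits are handled below.\<close>

lemma TensA_slide_left:
  assumes "f \<in> Ar C" "g \<in> Ar C"
  shows "f \<otimes> g = (f \<otimes> \<one> (Cod C g)) \<cdot> (\<one> (Dom C f) \<otimes> g)"
  using assms by (simp add: interchange)

lemma TensA_slide_right: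
  assumes "f \<in> Ar C" "g \<in> Ar C"
  shows "f \<otimes> g = (\<one> (Cod C f) \<otimes> g) \<cdot> (f \<otimes> \<one> (Dom C g))"
  using assms by (simp add: interchange)

end

section \<open>The Hopf bracoid of a single 1-cocycle\<close>

locale cocycle = strict_braided_monoidal_category C
  for C :: "('o, 'm, 'z) braided_category_scheme" (structure) +
  fixes H B :: "('o, 'm) hopf" and \<gamma> \<pi> :: 'm
  assumes one_cocycle: "one_cocycle C (H, B, \<gamma>, \<pi>)"
begin

abbreviation h :: 'o where "h \<equiv> car H"
abbreviation b :: 'o where "b \<equiv> car B"
abbreviation \<mu> :: 'm where "\<mu> \<equiv> mult B"
abbreviation \<eta> :: 'm where "\<eta> \<equiv> unit B"
abbreviation \<delta> :: 'm where "\<delta> \<equiv> comult H"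
abbreviation \<epsilon> :: 'm where "\<epsilon> \<equiv> counit H"

definition \<psi> :: 'm where "\<psi> = \<mu> \<cdot> (\<pi> \<otimes> \<gamma>) \<cdot> (\<delta> \<otimes> \<one> b)"

lemma hopf_H: "hopf_algebra C H" and hopf_B: "hopf_algebra C B"
  using one_cocycle by auto

lemmas hopf_unfold = hopf_algebra_def alg_of_def coalg_of_def unit_algebra_def left_module_def

lemma carriers [simp]: "h \<in> Ob C" "b \<in> Ob C"
  using hopf_H hopf_B by (auto simp: hopf_unfold)

lemma typing [simp]:
  "\<mu> \<in> Ar C" "Dom C \<mu> = b \<boxtimes> b" "Cod C \<mu> = b"
  "\<eta> \<in> Ar C" "Dom C \<eta> = \<K>" "Cod C \<eta> = b"
  "\<delta> \<in> Ar C" "Dom C \<delta> = h" "Cod C \<delta> = h \<boxtimes> h"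
  "\<epsilon> \<in> Ar C" "Dom C \<epsilon> = h" "Cod C \<epsilon> = \<K>"
  "mult H \<in> Ar C" "Dom C (mult H) = h \<boxtimes> h" "Cod C (mult H) = h"
  "unit H \<in> Ar C" "Dom C (unit H) = \<K>" "Cod C (unit H) = h"
  "comult B \<in> Ar C" "Dom C (comult B) = b" "Cod C (comult B) = b \<boxtimes> b"
  "counit B \<in> Ar C" "Dom C (counit B) = b" "Cod C (counit B) = \<K>"
  "antipode B \<in> Ar C" "Dom C (antipode B) = b" "Cod C (antipode B) = b"
  "\<gamma> \<in> Ar C" "Dom C \<gamma> = h \<boxtimes> b" "Cod C \<gamma> = b"
  "\<pi> \<in> Ar C" "Dom C \<pi> = h" "Cod C \<pi> = b"
  using one_cocycle by (auto simp: hopf_unfold Hom_def)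

lemma \<psi>_typing [simp]: "\<psi> \<in> Ar C" "Dom C \<psi> = h \<boxtimes> b" "Cod C \<psi> = b"
  by (simp_all add: \<psi>_def)

lemma structure_equations:
  shows mult_assoc: "\<mu> \<cdot> (\<one> b \<otimes> \<mu>) = \<mu> \<cdot> (\<mu> \<otimes> \<one> b)"
    and mult_unit_right: "\<mu> \<cdot> (\<one> b \<otimes> \<eta>) = \<one> b"
    and mult_unit_left: "\<mu> \<cdot> (\<eta> \<otimes> \<one> b) = \<one> b"
    and comult_coassoc: "(\<delta> \<otimes> \<one> h) \<cdot> \<delta> = (\<one> h \<otimes> \<delta>) \<cdot> \<delta>"
    and comult_counit_left: "(\<epsilon> \<otimes> \<one> h) \<cdot> \<delta> = \<one> h"
    and comult_counit_right: "(\<one> h \<otimes> \<epsilon>) \<cdot> \<delta> = \<one> h"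
    and antipode_left: "\<mu> \<cdot> (antipode B \<otimes> \<one> b) \<cdot> comult B = \<eta> \<cdot> counit B"
    and mult_H_unit: "mult H \<cdot> (\<one> h \<otimes> unit H) = \<one> h"
    and comult_mult: "\<delta> \<cdot> mult H = (mult H \<otimes> mult H) \<cdot> (\<one> h \<otimes> \<c> h h \<otimes> \<one> h) \<cdot> (\<delta> \<otimes> \<delta>)"
    and comult_unit: "\<delta> \<cdot> unit H = unit H \<otimes> unit H"
    and counit_unit: "\<epsilon> \<cdot> unit H = \<one> \<K>"
    and action_unit: "\<gamma> \<cdot> (unit H \<otimes> \<one> b) = \<one> b"
    and action_mult: "\<gamma> \<cdot> (\<one> h \<otimes> \<gamma>) = \<gamma> \<cdot> (mult H \<otimes> \<one> b)"
    and action_on_unit: "\<gamma> \<cdot> (\<one> h \<otimes> \<eta>) = \<epsilon> \<otimes> \<eta>"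
    and action_on_mult: "\<gamma> \<cdot> (\<one> h \<otimes> \<mu>) =
       \<mu> \<cdot> (\<gamma> \<otimes> \<gamma>) \<cdot> (\<one> h \<otimes> \<c> h b \<otimes> \<one> b) \<cdot> (\<delta> \<otimes> \<one> b \<otimes> \<one> b)"
    and counit_\<pi>: "counit B \<cdot> \<pi> = \<epsilon>"
    and comult_\<pi>: "(\<pi> \<otimes> \<pi>) \<cdot> \<delta> = comult B \<cdot> \<pi>"
    and cocycle_eq: "\<mu> \<cdot> (\<pi> \<otimes> \<gamma>) \<cdot> (\<delta> \<otimes> \<pi>) = \<pi> \<cdot> mult H"
  using one_cocycle by (simp_all add: hopf_unfold)

text \<open>\<open>one_cocycle\<close> asks of \<open>\<pi>\<close> only compatibility with the
  coalgebra structures and the cocycle identity, so preservation of units has to be derived. It is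
  what makes \<open>\<psi>\<close> unital.\<close>

lemma \<pi>_unit: "\<pi> \<cdot> unit H = \<eta>"
proof -
  let ?e = "\<pi> \<cdot> unit H"
  let ?l = "antipode B \<cdot> ?e"
  have act: "\<gamma> \<cdot> (unit H \<otimes> ?e) = ?e"
    using TensA_slide_left[of "unit H" ?e] by (simp add: Comp_reassoc[OF action_unit])
  \<comment> \<open>Writing the unit of \<open>H\<close> as its own square produces an instance of
    \<open>\<pi> \<cdot> mult H\<close>, to which the cocycle identity applies.\<close>
  have "?e = (\<pi> \<cdot> mult H) \<cdot> (unit H \<otimes> unit H)"
    using TensA_slide_right[of "unit H" "unit H"] by (simp add: Comp_reassoc[OF mult_H_unit])
  also have "\<dots> = (\<mu> \<cdot> (\<pi> \<otimes> \<gamma>) \<cdot> (\<delta> \<otimes> \<pi>)) \<cdot> (unit H \<otimes> unit H)"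
    by (simp only: cocycle_eq)
  also have "\<dots> = \<mu> \<cdot> (?e \<otimes> (\<gamma> \<cdot> (unit H \<otimes> ?e)))"
    by (simp add: contract comult_unit)
  finally have idem: "\<mu> \<cdot> (?e \<otimes> ?e) = ?e"
    by (simp only: act)
  \<comment> \<open>The unit of \<open>H\<close> is grouplike and \<open>\<pi>\<close> respects
    coproducts, so the antipode axiom of \<open>B\<close>, evaluated at \<open>?e\<close>, makes
    \<open>?l\<close> a left inverse of \<open>?e\<close>.\<close>
  have "\<mu> \<cdot> (?l \<otimes> ?e) = \<mu> \<cdot> (antipode B \<otimes> \<one> b) \<cdot> ((\<pi> \<otimes> \<pi>) \<cdot> \<delta>) \<cdot> unit H"
    by (simp add: comult_unit contract)
  also have "\<dots> = (\<mu> \<cdot> (antipode B \<otimes> \<one> b) \<cdot> comult B) \<cdot> \<pi> \<cdot> unit H"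
    by (subst comult_\<pi>) simp
  also have "\<dots> = \<eta> \<cdot> (counit B \<cdot> \<pi>) \<cdot> unit H"
    by (subst antipode_left) simp
  also have "\<dots> = \<eta>"
    by (simp add: counit_\<pi> counit_unit)
  finally have inv: "\<mu> \<cdot> (?l \<otimes> ?e) = \<eta>" .
  \<comment> \<open>Multiplying the idempotent on the left by \<open>?l\<close> and rebracketing
    cancels one copy of \<open>?e\<close>.\<close>
  have "\<eta> = \<mu> \<cdot> (?l \<otimes> (\<mu> \<cdot> (?e \<otimes> ?e)))"
    by (simp only: idem inv)
  also have "\<dots> = (\<mu> \<cdot> (\<one> b \<otimes> \<mu>)) \<cdot> (?l \<otimes> ?e \<otimes> ?e)"
    by (simp add: contract)
  also have "\<dots> = \<mu> \<cdot> (\<mu> \<otimes> \<one> b) \<cdot> ((?l \<otimes> ?e) \<otimes> ?e)"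
    by (subst mult_assoc) simp
  also have "\<dots> = \<mu> \<cdot> ((\<mu> \<cdot> (?l \<otimes> ?e)) \<otimes> ?e)"
    by (simp add: interchange del: TensA_assoc)
  also have "\<dots> = \<mu> \<cdot> (\<eta> \<otimes> ?e)"
    by (simp only: inv)
  also have "\<dots> = ?e"
    using TensA_slide_left[of \<eta> ?e] by (simp add: Comp_reassoc[OF mult_unit_left])
  finally show ?thesis ..
qed

text \<open>On the unit of \<open>B\<close>, a module algebra action reduces to the counit of
  \<open>H\<close>, so the convolution collapses to \<open>\<pi>\<close> convolved with the
  convolution unit \<open>\<eta> \<cdot> \<epsilon>\<close>.\<close>

lemma u_map_\<psi>: "u_map C H B \<psi> = \<pi>"
proof -
  have "\<epsilon> \<otimes> \<eta> = \<eta> \<cdot> \<epsilon>"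
    using TensA_slide_right[of \<epsilon> \<eta>] by simp
  then have act: "\<gamma> \<cdot> (\<one> h \<otimes> \<eta>) = \<eta> \<cdot> \<epsilon>"
    by (simp add: action_on_unit)
  have "u_map C H B \<psi> = \<mu> \<cdot> (\<pi> \<otimes> \<gamma>) \<cdot> (\<delta> \<otimes> \<eta>)"
    by (simp add: u_map_def \<psi>_def contract)
  also have "\<dots> = \<mu> \<cdot> (\<pi> \<otimes> \<gamma>) \<cdot> (\<one> h \<otimes> (\<one> h \<otimes> \<eta>)) \<cdot> \<delta>"
    using TensA_slide_right[of \<delta> \<eta>] by simp
  also have "\<dots> = \<mu> \<cdot> (\<pi> \<otimes> (\<eta> \<cdot> \<epsilon>)) \<cdot> \<delta>"
    by (simp add: interchange_Comp act del: Id_TensA_Id_TensA)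
  also have "\<pi> \<otimes> (\<eta> \<cdot> \<epsilon>) = (\<one> b \<otimes> \<eta>) \<cdot> \<pi> \<cdot> (\<one> h \<otimes> \<epsilon>)"
    using interchange[of \<pi> "\<one> b" \<epsilon> \<eta>] interchange[of "\<one> h" \<pi> \<epsilon> "\<one> \<K>"] by simp
  also have "\<mu> \<cdot> ((\<one> b \<otimes> \<eta>) \<cdot> \<pi> \<cdot> (\<one> h \<otimes> \<epsilon>)) \<cdot> \<delta> = \<pi>"
    by (simp add: Comp_reassoc[OF mult_unit_right] comult_counit_right)
  finally show ?thesis .
qed

text \<open>Since \<open>u_map\<close> returns \<open>\<pi>\<close>, the prefactor in
  \<open>Phi_map\<close> is the convolution inverse of \<open>\<pi>\<close> and undoes the passage
  from \<open>\<gamma>\<close> to \<open>\<psi>\<close>.\<close>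

lemma Phi_map_\<psi>: "Phi_map C H B \<psi> = \<gamma>"
proof -
  let ?l = "antipode B \<cdot> \<pi>"
  have "\<mu> \<cdot> (?l \<otimes> \<pi>) \<cdot> \<delta> = \<mu> \<cdot> (antipode B \<otimes> \<one> b) \<cdot> ((\<pi> \<otimes> \<pi>) \<cdot> \<delta>)"
    by (simp add: contract)
  also have "\<dots> = (\<mu> \<cdot> (antipode B \<otimes> \<one> b) \<cdot> comult B) \<cdot> \<pi>"
    by (subst comult_\<pi>) simp
  also have "\<dots> = \<eta> \<cdot> \<epsilon>"
    by (subst antipode_left) (simp add: counit_\<pi>)
  finally have inv: "\<mu> \<cdot> (?l \<otimes> \<pi>) \<cdot> \<delta> = \<eta> \<cdot> \<epsilon>" .
  have "Phi_map C H B \<psi> = \<mu> \<cdot> (?l \<otimes> (\<mu> \<cdot> (\<pi> \<otimes> \<gamma>) \<cdot> (\<delta> \<otimes> \<one> b))) \<cdot> (\<delta> \<otimes> \<one> b)"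
    unfolding Phi_map_def u_map_\<psi> by (simp add: \<psi>_def)
  also have "?l \<otimes> (\<mu> \<cdot> (\<pi> \<otimes> \<gamma>) \<cdot> (\<delta> \<otimes> \<one> b))
      = (\<one> b \<otimes> \<mu>) \<cdot> (?l \<otimes> \<pi> \<otimes> \<gamma>) \<cdot> ((\<one> h \<otimes> \<delta>) \<otimes> \<one> b)"
    by (simp add: interchange)
  also have "\<mu> \<cdot> ((\<one> b \<otimes> \<mu>) \<cdot> (?l \<otimes> \<pi> \<otimes> \<gamma>) \<cdot> ((\<one> h \<otimes> \<delta>) \<otimes> \<one> b)) \<cdot> (\<delta> \<otimes> \<one> b)
      = (\<mu> \<cdot> (\<one> b \<otimes> \<mu>)) \<cdot> (?l \<otimes> \<pi> \<otimes> \<gamma>) \<cdot> (((\<one> h \<otimes> \<delta>) \<cdot> \<delta>) \<otimes> \<one> b)"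
    by (simp add: interchange del: TensA_assoc)
  \<comment> \<open>Associativity of \<open>\<mu>\<close> and coassociativity of
    \<open>\<delta>\<close> together rebracket the triple convolution to the left, which exposes the
    left-hand side of \<open>inv\<close>.\<close>
  also have "\<dots> = \<mu> \<cdot> (\<mu> \<otimes> \<one> b) \<cdot> ((?l \<otimes> \<pi>) \<otimes> \<gamma>) \<cdot> (((\<delta> \<otimes> \<one> h) \<cdot> \<delta>) \<otimes> \<one> b)"
    by (subst mult_assoc) (simp add: comult_coassoc)
  also have "((\<delta> \<otimes> \<one> h) \<cdot> \<delta>) \<otimes> \<one> b = (\<delta> \<otimes> \<one> (h \<boxtimes> b)) \<cdot> (\<delta> \<otimes> \<one> b)"
    using interchange[of \<delta> "\<delta> \<otimes> \<one> h" "\<one> b" "\<one> b"] by (simp add: TensA_Id)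
  also have "\<mu> \<cdot> (\<mu> \<otimes> \<one> b) \<cdot> ((?l \<otimes> \<pi>) \<otimes> \<gamma>) \<cdot> (\<delta> \<otimes> \<one> (h \<boxtimes> b)) \<cdot> (\<delta> \<otimes> \<one> b)
      = \<mu> \<cdot> ((\<mu> \<cdot> (?l \<otimes> \<pi>) \<cdot> \<delta>) \<otimes> \<gamma>) \<cdot> (\<delta> \<otimes> \<one> b)"
    by (simp add: interchange_Comp del: TensA_assoc)
  also have "\<dots> = \<mu> \<cdot> ((\<eta> \<cdot> \<epsilon>) \<otimes> \<gamma>) \<cdot> (\<delta> \<otimes> \<one> b)"
    by (simp only: inv)
  \<comment> \<open>The factor is split so that \<open>\<eta>\<close> meets \<open>\<mu>\<close> and
    \<open>\<epsilon>\<close> meets \<open>\<delta>\<close>; the unit and counit laws then leave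
    \<open>\<gamma>\<close>.\<close>
  also have "(\<eta> \<cdot> \<epsilon>) \<otimes> \<gamma> = (\<eta> \<otimes> \<one> b) \<cdot> \<gamma> \<cdot> ((\<epsilon> \<otimes> \<one> h) \<otimes> \<one> b)"
    using interchange[of \<epsilon> \<eta> \<gamma> "\<one> b"] interchange[of \<epsilon> "\<one> \<K>" "\<one> (h \<boxtimes> b)" \<gamma>]
    by (simp add: TensA_Id)
  also have "\<mu> \<cdot> ((\<eta> \<otimes> \<one> b) \<cdot> \<gamma> \<cdot> ((\<epsilon> \<otimes> \<one> h) \<otimes> \<one> b)) \<cdot> (\<delta> \<otimes> \<one> b) = \<gamma>"
    by (simp add: Comp_reassoc[OF mult_unit_left] interchange comult_counit_left TensA_Id
        del: TensA_assoc)
  finally show ?thesis .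
qed

text \<open>The multiplicativity of \<open>\<gamma>\<close> is convolved with \<open>\<pi>\<close>
  on the left; coassociativity then groups \<open>\<pi>\<close> with the first of the two actions
  into \<open>\<psi>\<close>. By \<open>Phi_map_\<psi>\<close> this is exactly the bracoid
  axiom.\<close>

lemma \<psi>_mult:
  "\<psi> \<cdot> (\<one> h \<otimes> \<mu>) = \<mu> \<cdot> (\<psi> \<otimes> \<gamma>) \<cdot> (\<one> h \<otimes> \<c> h b \<otimes> \<one> b) \<cdot> (\<delta> \<otimes> \<one> b \<otimes> \<one> b)"
proof -
  let ?c = "\<one> h \<otimes> \<c> h b \<otimes> \<one> b"
  have "\<psi> \<cdot> (\<one> h \<otimes> \<mu>) = \<mu> \<cdot> (\<pi> \<otimes> \<gamma>) \<cdot> (\<one> h \<otimes> \<one> h \<otimes> \<mu>) \<cdot> (\<delta> \<otimes> \<one> b \<otimes> \<one> b)"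
    by (simp add: \<psi>_def contract)
  also have "\<dots> = \<mu> \<cdot> (\<pi> \<otimes> (\<gamma> \<cdot> (\<one> h \<otimes> \<mu>))) \<cdot> (\<delta> \<otimes> \<one> b \<otimes> \<one> b)"
    by (simp add: interchange_Comp del: Id_TensA_Id_TensA)
  also have "\<dots> = \<mu> \<cdot> (\<pi> \<otimes> (\<mu> \<cdot> (\<gamma> \<otimes> \<gamma>) \<cdot> ?c \<cdot> (\<delta> \<otimes> \<one> b \<otimes> \<one> b))) \<cdot> (\<delta> \<otimes> \<one> b \<otimes> \<one> b)"
    by (simp only: action_on_mult)
  also have "\<pi> \<otimes> (\<mu> \<cdot> (\<gamma> \<otimes> \<gamma>) \<cdot> ?c \<cdot> (\<delta> \<otimes> \<one> b \<otimes> \<one> b))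
      = (\<one> b \<otimes> \<mu>) \<cdot> (\<pi> \<otimes> \<gamma> \<otimes> \<gamma>) \<cdot> (\<one> h \<otimes> ?c) \<cdot> ((\<one> h \<otimes> \<delta>) \<otimes> \<one> b \<otimes> \<one> b)"
    by (simp add: interchange del: Id_TensA_Id_TensA)
  also have "\<mu> \<cdot> ((\<one> b \<otimes> \<mu>) \<cdot> (\<pi> \<otimes> \<gamma> \<otimes> \<gamma>) \<cdot> (\<one> h \<otimes> ?c) \<cdot> ((\<one> h \<otimes> \<delta>) \<otimes> \<one> b \<otimes> \<one> b))
        \<cdot> (\<delta> \<otimes> \<one> b \<otimes> \<one> b)
      = (\<mu> \<cdot> (\<one> b \<otimes> \<mu>)) \<cdot> (\<pi> \<otimes> \<gamma> \<otimes> \<gamma>) \<cdot> (\<one> h \<otimes> ?c) \<cdot> (((\<one> h \<otimes> \<delta>) \<cdot> \<delta>) \<otimes> \<one> b \<otimes> \<one> b)"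
    by (simp add: interchange del: TensA_assoc Id_TensA_Id_TensA)
  also have "\<dots> = \<mu> \<cdot> (\<mu> \<otimes> \<one> b) \<cdot> ((\<pi> \<otimes> \<gamma>) \<otimes> \<gamma>) \<cdot> (\<one> h \<otimes> ?c) \<cdot> (((\<delta> \<otimes> \<one> h) \<cdot> \<delta>) \<otimes> \<one> b \<otimes> \<one> b)"
    by (subst mult_assoc) (simp add: comult_coassoc)
  also have "\<dots> = \<mu> \<cdot> ((\<mu> \<cdot> (\<pi> \<otimes> \<gamma>)) \<otimes> \<gamma>) \<cdot> (\<one> h \<otimes> ?c) \<cdot> (((\<delta> \<otimes> \<one> h) \<cdot> \<delta>) \<otimes> \<one> b \<otimes> \<one> b)"
    by (simp add: interchange_Comp del: TensA_assoc)
  also have "((\<delta> \<otimes> \<one> h) \<cdot> \<delta>) \<otimes> \<one> b \<otimes> \<one> b = (\<delta> \<otimes> \<one> h \<otimes> \<one> b \<otimes> \<one> b) \<cdot> (\<delta> \<otimes> \<one> b \<otimes> \<one> b)"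
    using interchange[of \<delta> "\<delta> \<otimes> \<one> h" "\<one> b \<otimes> \<one> b" "\<one> b \<otimes> \<one> b"] by (simp add: TensA_Id)
  \<comment> \<open>The coproduct acts on the first strand and the braiding on the next two, so they
    commute by interchange alone, without naturality.\<close>
  also have "(\<one> h \<otimes> ?c) \<cdot> (\<delta> \<otimes> \<one> h \<otimes> \<one> b \<otimes> \<one> b) \<cdot> (\<delta> \<otimes> \<one> b \<otimes> \<one> b)
      = (\<delta> \<otimes> \<one> b \<otimes> \<one> h \<otimes> \<one> b) \<cdot> ?c \<cdot> (\<delta> \<otimes> \<one> b \<otimes> \<one> b)"
    by (simp add: contract)
  \<comment> \<open>Only the bracketing changes: \<open>\<delta> \<otimes> \<one> b\<close> becomes
    a single factor directly below \<open>\<mu> \<cdot> (\<pi> \<otimes> \<gamma>)\<close>,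
    completing \<open>\<psi>\<close>.\<close>
  also have "\<mu> \<cdot> ((\<mu> \<cdot> (\<pi> \<otimes> \<gamma>)) \<otimes> \<gamma>) \<cdot> (\<delta> \<otimes> \<one> b \<otimes> \<one> h \<otimes> \<one> b) \<cdot> ?c \<cdot> (\<delta> \<otimes> \<one> b \<otimes> \<one> b)
      = \<mu> \<cdot> ((\<mu> \<cdot> (\<pi> \<otimes> \<gamma>)) \<otimes> \<gamma>) \<cdot> ((\<delta> \<otimes> \<one> b) \<otimes> (\<one> h \<otimes> \<one> b)) \<cdot> ?c \<cdot> (\<delta> \<otimes> \<one> b \<otimes> \<one> b)"
    by simp
  also have "\<dots> = \<mu> \<cdot> (\<psi> \<otimes> \<gamma>) \<cdot> ?c \<cdot> (\<delta> \<otimes> \<one> b \<otimes> \<one> b)"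
    by (simp add: interchange_Comp TensA_Id \<psi>_def del: TensA_assoc)
  finally show ?thesis .
qed

text \<open>The cocycle identity in another reading: \<open>\<pi>\<close> intertwines the regular
  action of \<open>H\<close> on itself with \<open>\<psi>\<close>.\<close>

lemma \<psi>_\<pi>: "\<psi> \<cdot> (\<one> h \<otimes> \<pi>) = \<pi> \<cdot> mult H"
  by (simp add: \<psi>_def contract cocycle_eq)

lemma \<psi>_unit: "\<psi> \<cdot> (unit H \<otimes> \<one> b) = \<one> b"
proof -
  have "\<psi> \<cdot> (unit H \<otimes> \<one> b) = \<mu> \<cdot> (\<pi> \<otimes> \<gamma>) \<cdot> (unit H \<otimes> (unit H \<otimes> \<one> b))"
    by (simp add: \<psi>_def contract comult_unit)
  also have "\<dots> = \<mu> \<cdot> (\<eta> \<otimes> \<one> b)"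
    by (simp add: interchange \<pi>_unit action_unit)
  finally show ?thesis
    by (simp add: mult_unit_left)
qed

text \<open>Expanding the inner \<open>\<psi>\<close> as a product, \<open>\<psi>_mult\<close>
  distributes the outer one over it. The two factors are then handled by \<open>\<psi>_\<pi>\<close>
  and \<open>action_mult\<close>, and multiplicativity of \<open>\<delta>\<close> reassembles
  \<open>\<psi>\<close>.\<close>

lemma \<psi>_action: "\<psi> \<cdot> (\<one> h \<otimes> \<psi>) = \<psi> \<cdot> (mult H \<otimes> \<one> b)"
proof -
  \<comment> \<open>Following \<open>?d\<close> by \<open>mult H \<otimes> mult H\<close> gives the
    right-hand side of \<open>comult_mult\<close>.\<close>
  let ?d = "(\<one> h \<otimes> \<c> h h \<otimes> \<one> h) \<cdot> (\<delta> \<otimes> \<delta>)"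
  \<comment> \<open>Naturality moves \<open>\<pi>\<close> above the crossing, next to
    \<open>\<psi>\<close>, and turns the braiding of \<open>H\<close> with \<open>B\<close> into the
    one of \<open>H\<close> with itself that \<open>?d\<close> contains.\<close>
  have nat: "\<c> h b \<cdot> (\<one> h \<otimes> \<pi>) = (\<pi> \<otimes> \<one> h) \<cdot> \<c> h h"
    using Braid_natural[of "\<one> h" h h \<pi> h b] by (simp add: Hom_def)
  have "((\<pi> \<otimes> \<one> h) \<cdot> \<c> h h) \<otimes> \<gamma> = ((\<pi> \<otimes> \<one> h) \<otimes> \<gamma>) \<cdot> (\<c> h h \<otimes> \<one> (h \<boxtimes> b))"
    by (simp add: interchange del: TensA_assoc)
  then have e: "\<one> h \<otimes> ((\<pi> \<otimes> \<one> h) \<cdot> \<c> h h) \<otimes> \<gamma>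
      = ((\<one> h \<otimes> \<pi>) \<otimes> (\<one> h \<otimes> \<gamma>)) \<cdot> (\<one> h \<otimes> \<c> h h \<otimes> \<one> (h \<boxtimes> b))"
    by (simp add: interchange)
  have d: "?d \<otimes> \<one> b = (\<one> h \<otimes> \<c> h h \<otimes> \<one> (h \<boxtimes> b)) \<cdot> (\<delta> \<otimes> \<delta> \<otimes> \<one> b)"
    using interchange[of "\<delta> \<otimes> \<delta>" "\<one> h \<otimes> \<c> h h \<otimes> \<one> h" "\<one> b" "\<one> b"] by (simp add: TensA_Id)
  have "\<psi> \<cdot> (\<one> h \<otimes> \<psi>) = (\<psi> \<cdot> (\<one> h \<otimes> \<mu>)) \<cdot> (\<one> h \<otimes> \<pi> \<otimes> \<gamma>) \<cdot> (\<one> h \<otimes> \<delta> \<otimes> \<one> b)"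
    by (simp add: interchange \<psi>_def)
  also have "\<dots> = \<mu> \<cdot> (\<psi> \<otimes> \<gamma>) \<cdot> (\<one> h \<otimes> \<c> h b \<otimes> \<one> b) \<cdot> (\<delta> \<otimes> \<one> b \<otimes> \<one> b)
      \<cdot> (\<one> h \<otimes> \<pi> \<otimes> \<gamma>) \<cdot> (\<one> h \<otimes> \<delta> \<otimes> \<one> b)"
    by (subst \<psi>_mult) simp
  also have "(\<delta> \<otimes> \<one> b \<otimes> \<one> b) \<cdot> (\<one> h \<otimes> \<pi> \<otimes> \<gamma>) \<cdot> (\<one> h \<otimes> \<delta> \<otimes> \<one> b)
      = (\<one> h \<otimes> (\<one> h \<otimes> \<pi>) \<otimes> \<gamma>) \<cdot> (\<delta> \<otimes> \<delta> \<otimes> \<one> b)"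
    by (simp add: contract)
  also have "(\<one> h \<otimes> \<c> h b \<otimes> \<one> b) \<cdot> (\<one> h \<otimes> (\<one> h \<otimes> \<pi>) \<otimes> \<gamma>) \<cdot> (\<delta> \<otimes> \<delta> \<otimes> \<one> b)
      = (\<one> h \<otimes> (\<c> h b \<cdot> (\<one> h \<otimes> \<pi>)) \<otimes> \<gamma>) \<cdot> (\<delta> \<otimes> \<delta> \<otimes> \<one> b)"
    by (simp add: interchange_Comp interchange del: TensA_assoc)
  also have "\<dots> = (\<one> h \<otimes> ((\<pi> \<otimes> \<one> h) \<cdot> \<c> h h) \<otimes> \<gamma>) \<cdot> (\<delta> \<otimes> \<delta> \<otimes> \<one> b)"
    by (simp only: nat)
  also have "\<dots> = ((\<one> h \<otimes> \<pi>) \<otimes> (\<one> h \<otimes> \<gamma>)) \<cdot> (?d \<otimes> \<one> b)"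
    by (simp only: e d) simp
  also have "\<mu> \<cdot> (\<psi> \<otimes> \<gamma>) \<cdot> \<dots> = \<mu> \<cdot> ((\<pi> \<cdot> mult H) \<otimes> (\<gamma> \<cdot> (mult H \<otimes> \<one> b))) \<cdot> (?d \<otimes> \<one> b)"
    by (simp add: interchange_Comp \<psi>_\<pi> action_mult del: TensA_assoc)
  also have "\<dots> = \<mu> \<cdot> (\<pi> \<otimes> \<gamma>) \<cdot> (((mult H \<otimes> mult H) \<cdot> ?d) \<otimes> \<one> b)"
  proof -
    have "(\<pi> \<cdot> mult H) \<otimes> (\<gamma> \<cdot> (mult H \<otimes> \<one> b)) = (\<pi> \<otimes> \<gamma>) \<cdot> ((mult H \<otimes> mult H) \<otimes> \<one> b)"
      by (simp add: interchange)
    moreover have "((mult H \<otimes> mult H) \<cdot> ?d) \<otimes> \<one> b = ((mult H \<otimes> mult H) \<otimes> \<one> b) \<cdot> (?d \<otimes> \<one> b)"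
      using interchange[of ?d "mult H \<otimes> mult H" "\<one> b" "\<one> b"] by simp
    ultimately show ?thesis
      by simp
  qed
  also have "\<dots> = \<mu> \<cdot> (\<pi> \<otimes> \<gamma>) \<cdot> ((\<delta> \<cdot> mult H) \<otimes> \<one> b)"
    by (simp only: comult_mult)
  also have "\<dots> = \<psi> \<cdot> (mult H \<otimes> \<one> b)"
    by (simp add: \<psi>_def interchange)
  finally show ?thesis .
qed

lemma hopf_bracoid_\<psi>: "hopf_bracoid C (H, B, \<psi>)"
  using hopf_H hopf_B \<psi>_unit \<psi>_action \<psi>_mult
  by (simp add: left_module_def Hom_def Phi_map_\<psi>)

end

section \<open>Hopf morphisms and compatibility with the induced actions\<close>

context strict_braided_monoidal_category
begin

lemma hopf_morphism_typing:
  assumes "hopf_morphism C X Y f"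
  shows "f \<in> Hom C (car X) (car Y)"
  using assms by (simp add: hopf_morphism_def alg_of_def)

lemma hopf_morphism_Id:
  assumes "hopf_algebra C X"
  shows "hopf_morphism C X X (\<one> (car X))"
  using assms
  by (simp add: hopf_morphism_def hopf_algebra_def alg_of_def coalg_of_def unit_algebra_def Hom_def
      contract)

lemma hopf_morphism_Comp:
  assumes X: "hopf_algebra C X" and Y: "hopf_algebra C Y" and Z: "hopf_algebra C Z"
    and f: "hopf_morphism C X Y f" and g: "hopf_morphism C Y Z g"
  shows "hopf_morphism C X Z (g \<cdot> f)"
proof -
  note defs = hopf_morphism_def hopf_algebra_def alg_of_def coalg_of_def unit_algebra_def
  have [simp]: "unit X \<in> Ar C" "Dom C (unit X) = \<K>" "Cod C (unit X) = car X"
    "mult X \<in> Ar C" "Dom C (mult X) = car X \<boxtimes> car X" "Cod C (mult X) = car X"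
    "comult X \<in> Ar C" "Dom C (comult X) = car X" "Cod C (comult X) = car X \<boxtimes> car X"
    "mult Y \<in> Ar C" "Dom C (mult Y) = car Y \<boxtimes> car Y" "Cod C (mult Y) = car Y"
    "comult Y \<in> Ar C" "Dom C (comult Y) = car Y" "Cod C (comult Y) = car Y \<boxtimes> car Y"
    "mult Z \<in> Ar C" "Dom C (mult Z) = car Z \<boxtimes> car Z" "Cod C (mult Z) = car Z"
    "counit Z \<in> Ar C" "Dom C (counit Z) = car Z" "Cod C (counit Z) = \<K>"
    "comult Z \<in> Ar C" "Dom C (comult Z) = car Z" "Cod C (comult Z) = car Z \<boxtimes> car Z"
    "f \<in> Ar C" "Dom C f = car X" "Cod C f = car Y" "g \<in> Ar C" "Dom C g = car Y" "Cod C g = car Z"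
    using X Y Z f g by (auto simp: defs Hom_def)
  have eqs: "f \<cdot> unit X = unit Y" "g \<cdot> unit Y = unit Z"
    "counit Y \<cdot> f = counit X" "counit Z \<cdot> g = counit Y"
    "mult Y \<cdot> (f \<otimes> f) = f \<cdot> mult X" "mult Z \<cdot> (g \<otimes> g) = g \<cdot> mult Y"
    "(f \<otimes> f) \<cdot> comult X = comult Y \<cdot> f" "(g \<otimes> g) \<cdot> comult Y = comult Z \<cdot> g"
    using f g by (simp_all add: defs)
  have "counit Z \<cdot> g \<cdot> f = counit X"
    using Comp_reassoc[OF eqs(4), of f] by (simp add: eqs)
  moreover have "mult Z \<cdot> ((g \<cdot> f) \<otimes> (g \<cdot> f)) = g \<cdot> f \<cdot> mult X"
    using Comp_reassoc[OF eqs(6), of "f \<otimes> f"] by (simp add: interchange eqs)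
  moreover have "((g \<cdot> f) \<otimes> (g \<cdot> f)) \<cdot> comult X = comult Z \<cdot> g \<cdot> f"
  proof -
    have "((g \<cdot> f) \<otimes> (g \<cdot> f)) \<cdot> comult X = (g \<otimes> g) \<cdot> (f \<otimes> f) \<cdot> comult X"
      by (simp add: interchange_Comp)
    also have "\<dots> = comult Z \<cdot> g \<cdot> f"
      unfolding eqs(7) using Comp_reassoc[OF eqs(8), of f] by simp
    finally show ?thesis .
  qed
  ultimately show ?thesis
    by (simp add: defs Hom_def eqs)
qed

text \<open>Every ingredient of the induced action is transported: \<open>g\<close> respects
  products, \<open>f\<close> respects coproducts, and the pair intertwines both the cocycles and the
  actions.\<close>

lemma hopf_bracoid_morphism_of_cocycle_morphism:
  assumes X: "one_cocycle C (H, B, \<gamma>, \<pi>)" and Y: "one_cocycle C (H', B', \<gamma>', \<tau>)"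
    and fg: "one_cocycle_morphism C (H, B, \<gamma>, \<pi>) (H', B', \<gamma>', \<tau>) (f, g)"
  shows "hopf_bracoid_morphism C
    (H, B, mult B \<cdot> (\<pi> \<otimes> \<gamma>) \<cdot> (comult H \<otimes> \<one> (car B)))
    (H', B', mult B' \<cdot> (\<tau> \<otimes> \<gamma>') \<cdot> (comult H' \<otimes> \<one> (car B'))) (f, g)"
proof -
  interpret X: cocycle C H B \<gamma> \<pi> by unfold_locales (fact X)
  interpret Y: cocycle C H' B' \<gamma>' \<tau> by unfold_locales (fact Y)
  have f: "hopf_morphism C H H' f" and g: "hopf_morphism C B B' g"
    and pi: "g \<cdot> \<pi> = \<tau> \<cdot> f" and act: "g \<cdot> \<gamma> = \<gamma>' \<cdot> (f \<otimes> g)"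
    using fg by simp_all
  note [simp] = HomD[OF hopf_morphism_typing[OF f]] HomD[OF hopf_morphism_typing[OF g]]
  have mu: "g \<cdot> mult B = mult B' \<cdot> (g \<otimes> g)" and delta: "(f \<otimes> f) \<cdot> comult H = comult H' \<cdot> f"
    using f g by (simp_all add: hopf_morphism_def alg_of_def coalg_of_def)
  have "g \<cdot> mult B \<cdot> (\<pi> \<otimes> \<gamma>) \<cdot> (comult H \<otimes> \<one> (car B))
      = mult B' \<cdot> ((g \<cdot> \<pi>) \<otimes> (g \<cdot> \<gamma>)) \<cdot> (comult H \<otimes> \<one> (car B))"
    by (simp add: Comp_reassoc[OF mu] interchange_Comp)
  also have "\<dots> = mult B' \<cdot> (\<tau> \<otimes> \<gamma>') \<cdot> ((f \<otimes> f) \<otimes> g) \<cdot> (comult H \<otimes> \<one> (car B))"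
    by (simp add: pi act interchange_Comp)
  also have "((f \<otimes> f) \<otimes> g) \<cdot> (comult H \<otimes> \<one> (car B)) = (comult H' \<otimes> \<one> (car B')) \<cdot> (f \<otimes> g)"
    by (simp add: interchange delta del: TensA_assoc)
  finally show ?thesis
    using f g by simp
qed

text \<open>Common shape of \<open>OneC\<close> and \<open>HBrcd\<close>; \<open>s\<close> and \<open>t\<close> are the underlying objects of the two
  components of a morphism.\<close>

lemma category_of_tagged_pairs:
  assumes mor_typing: "\<And>X Y f g. mor X Y (f, g) \<Longrightarrow> f \<in> Hom C (s X) (s Y) \<and> g \<in> Hom C (t X) (t Y)"
    and mor_Id: "\<And>X. ob X \<Longrightarrow> mor X X (\<one> (s X), \<one> (t X))"
    and mor_Comp: "\<And>X Y Z f g f' g'. ob X \<Longrightarrow> ob Y \<Longrightarrow> ob Z \<Longrightarrow> mor X Y (f, g) \<Longrightarrow> mor Y Z (f', g')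
      \<Longrightarrow> mor X Z (f' \<cdot> f, g' \<cdot> g)"
  shows "category \<lparr>
     Ob = {X. ob X},
     Ar = {(X, p, Y). ob X \<and> ob Y \<and> mor X Y p},
     Dom = (\<lambda>(X, p, Y). X),
     Cod = (\<lambda>(X, p, Y). Y),
     Id = (\<lambda>X. (X, (\<one> (s X), \<one> (t X)), X)),
     Comp = (\<lambda>(Y', (f', g'), Z) (X, (f, g), Y). (X, (f' \<cdot> f, g' \<cdot> g), Z)) \<rparr>"
  (is "category ?P")
proof -
  \<comment> \<open>An arrow of \<open>?P\<close> is a triple whose tags are its ends; this
    elimination exposes the underlying pair, so each category law reduces to laws of
    \<open>C\<close> in both components.\<close>
  have HomE: thesis
    if "F \<in> Hom ?P X Y"
      "\<And>f g. F = (X, (f, g), Y) \<Longrightarrow> ob X \<Longrightarrow> ob Y \<Longrightarrow> mor X Y (f, g) \<Longrightarrow> thesis" for F X Y thesis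
    using that by (auto simp: Hom_def)
  show ?thesis
  proof
    fix F G X Y Z
    assume "F \<in> Hom ?P X Y" "G \<in> Hom ?P Y Z"
    then show "Comp ?P G F \<in> Hom ?P X Z"
      by (elim HomE) (simp add: Hom_def mor_Comp)
  next
    fix F X Y
    assume "F \<in> Hom ?P X Y"
    then show "Comp ?P (Id ?P Y) F = F" "Comp ?P F (Id ?P X) = F"
      using mor_typing by (elim HomE; simp; blast intro: Id_left Id_right)+
  next
    fix F G K X Y Z W
    assume "F \<in> Hom ?P X Y" "G \<in> Hom ?P Y Z" "K \<in> Hom ?P Z W"
    then show "Comp ?P (Comp ?P K G) F = Comp ?P K (Comp ?P G F)"
      using mor_typing by (elim HomE) (simp, blast intro: Comp_assoc)
  qed (auto simp: Hom_def mor_Id)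
qed

text \<open>Two commuting squares are pasted. This serves the actions \<open>\<gamma>\<close> in
  \<open>OneC\<close> and \<open>\<phi>\<close> in \<open>HBrcd\<close> alike.\<close>

lemma equivariant_Comp:
  assumes "g \<cdot> \<phi> = \<phi>' \<cdot> (f \<otimes> g)" "g' \<cdot> \<phi>' = \<phi>'' \<cdot> (f' \<otimes> g')"
    and "\<phi> \<in> Hom C (A \<boxtimes> M) M" "\<phi>' \<in> Hom C (A' \<boxtimes> M') M'" "\<phi>'' \<in> Hom C (A'' \<boxtimes> M'') M''"
    and "f \<in> Hom C A A'" "f' \<in> Hom C A' A''" "g \<in> Hom C M M'" "g' \<in> Hom C M' M''"
  shows "(g' \<cdot> g) \<cdot> \<phi> = \<phi>'' \<cdot> ((f' \<cdot> f) \<otimes> (g' \<cdot> g))"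
proof -
  note [simp] = assms(3-)[THEN HomD(1)] assms(3-)[THEN HomD(2)] assms(3-)[THEN HomD(3)]
  show ?thesis
    using Comp_reassoc[OF assms(2), of "f \<otimes> g"] by (simp add: assms(1) interchange)
qed

section \<open>The categories of 1-cocycles and of Hopf bracoids\<close>

lemma category_OneC: "category (OneC C)"
proof -
  let ?s = "\<lambda>X. car (fst X)" and ?t = "\<lambda>X. car (fst (snd X))"
  \<comment> \<open>The tuple pattern in \<open>Id\<close> is replaced by the projections
    \<open>?s\<close> and \<open>?t\<close>, so that the record has the shape treated by
    \<open>category_of_tagged_pairs\<close>.\<close>
  have "OneC C = \<lparr>
     Ob = {X. one_cocycle C X},
     Ar = {(X, p, Y). one_cocycle C X \<and> one_cocycle C Y \<and> one_cocycle_morphism C X Y p},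
     Dom = (\<lambda>(X, p, Y). X),
     Cod = (\<lambda>(X, p, Y). Y),
     Id = (\<lambda>X. (X, (\<one> (?s X), \<one> (?t X)), X)),
     Comp = (\<lambda>(Y', (f', g'), Z) (X, (f, g), Y). (X, (f' \<cdot> f, g' \<cdot> g), Z)) \<rparr>"
    by (auto simp: OneC_def)
  moreover have "category \<dots>"
  proof (rule category_of_tagged_pairs, goal_cases)
    case (1 X Y f g)
    then show ?case
      by (cases X, cases Y) (auto intro: hopf_morphism_typing)
  next
    case (2 X)
    obtain H B \<gamma> \<pi> where X: "X = (H, B, \<gamma>, \<pi>)" by (cases X)
    interpret cocycle C H B \<gamma> \<pi> by unfold_locales (use 2 X in simp)
    show ?case
      by (simp add: X hopf_morphism_Id hopf_H hopf_B TensA_Id)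
  next
    case (3 X Y Z f g f' g')
    obtain H B \<gamma> \<pi> where X: "X = (H, B, \<gamma>, \<pi>)" by (cases X)
    obtain H' B' \<gamma>' \<pi>' where Y: "Y = (H', B', \<gamma>', \<pi>')" by (cases Y)
    obtain H'' B'' \<gamma>'' \<pi>'' where Z: "Z = (H'', B'', \<gamma>'', \<pi>'')" by (cases Z)
    interpret X: cocycle C H B \<gamma> \<pi> by unfold_locales (use 3 X in simp)
    interpret Y: cocycle C H' B' \<gamma>' \<pi>' by unfold_locales (use 3 Y in simp)
    interpret Z: cocycle C H'' B'' \<gamma>'' \<pi>'' by unfold_locales (use 3 Z in simp)
    have mor: "hopf_morphism C H H' f" "hopf_morphism C B B' g"
      "hopf_morphism C H' H'' f'" "hopf_morphism C B' B'' g'"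
      and eqs: "\<pi>' \<cdot> f = g \<cdot> \<pi>" "\<pi>'' \<cdot> f' = g' \<cdot> \<pi>'" "g \<cdot> \<gamma> = \<gamma>' \<cdot> (f \<otimes> g)" "g' \<cdot> \<gamma>' = \<gamma>'' \<cdot> (f' \<otimes> g')"
      using 3(4,5) by (simp_all add: X Y Z)
    note homs = mor[THEN hopf_morphism_typing]
    note [simp] = homs[THEN HomD(1)] homs[THEN HomD(2)] homs[THEN HomD(3)]
    have "hopf_morphism C H H'' (f' \<cdot> f)" "hopf_morphism C B B'' (g' \<cdot> g)"
      using mor X.hopf_H X.hopf_B Y.hopf_H Y.hopf_B Z.hopf_H Z.hopf_B hopf_morphism_Comp by blast+
    moreover have "\<pi>'' \<cdot> f' \<cdot> f = (g' \<cdot> g) \<cdot> \<pi>"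
      using Comp_reassoc[OF eqs(2), of f] by (simp add: eqs(1))
    moreover have "(g' \<cdot> g) \<cdot> \<gamma> = \<gamma>'' \<cdot> ((f' \<cdot> f) \<otimes> (g' \<cdot> g))"
      by (rule equivariant_Comp[OF eqs(3,4) _ _ _ homs(1,3,2,4)]) (simp_all add: Hom_def)
    ultimately show ?case
      by (simp only: X Z one_cocycle_morphism.simps)
  qed
  ultimately show ?thesis by simp
qed

lemma category_HBrcd: "category (HBrcd C)"
proof -
  let ?s = "\<lambda>X. car (fst X)" and ?t = "\<lambda>X. car (fst (snd X))"
  have "HBrcd C = \<lparr>
     Ob = {X. hopf_bracoid C X},
     Ar = {(X, p, Y). hopf_bracoid C X \<and> hopf_bracoid C Y \<and> hopf_bracoid_morphism C X Y p},
     Dom = (\<lambda>(X, p, Y). X),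
     Cod = (\<lambda>(X, p, Y). Y),
     Id = (\<lambda>X. (X, (\<one> (?s X), \<one> (?t X)), X)),
     Comp = (\<lambda>(Y', (f', g'), Z) (X, (f, g), Y). (X, (f' \<cdot> f, g' \<cdot> g), Z)) \<rparr>"
    by (auto simp: HBrcd_def)
  moreover have "category \<dots>"
  proof (rule category_of_tagged_pairs, goal_cases)
    case (1 X Y f g)
    then show ?case
      by (cases X, cases Y) (auto intro: hopf_morphism_typing)
  next
    case (2 X)
    obtain H B \<phi> where X: "X = (H, B, \<phi>)" by (cases X)
    have H: "hopf_algebra C H" and B: "hopf_algebra C B" and \<phi>: "\<phi> \<in> Hom C (car H \<boxtimes> car B) (car B)"
      using 2 by (simp_all add: X left_module_def)
    have "car H \<in> Ob C" "car B \<in> Ob C"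
      using H B by (simp_all add: hopf_algebra_def alg_of_def)
    then show ?case
      using HomD[OF \<phi>] by (simp add: X hopf_morphism_Id H B TensA_Id)
  next
    case (3 X Y Z f g f' g')
    obtain H B \<phi> where X: "X = (H, B, \<phi>)" by (cases X)
    obtain H' B' \<phi>' where Y: "Y = (H', B', \<phi>')" by (cases Y)
    obtain H'' B'' \<phi>'' where Z: "Z = (H'', B'', \<phi>'')" by (cases Z)
    have hopf: "hopf_algebra C H" "hopf_algebra C H'" "hopf_algebra C H''"
        "hopf_algebra C B" "hopf_algebra C B'" "hopf_algebra C B''"
      and \<phi>: "\<phi> \<in> Hom C (car H \<boxtimes> car B) (car B)" "\<phi>' \<in> Hom C (car H' \<boxtimes> car B') (car B')"
        "\<phi>'' \<in> Hom C (car H'' \<boxtimes> car B'') (car B'')"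
      using 3(1-3) by (simp_all add: X Y Z left_module_def)
    have mor: "hopf_morphism C H H' f" "hopf_morphism C B B' g"
      "hopf_morphism C H' H'' f'" "hopf_morphism C B' B'' g'"
      and eqs: "g \<cdot> \<phi> = \<phi>' \<cdot> (f \<otimes> g)" "g' \<cdot> \<phi>' = \<phi>'' \<cdot> (f' \<otimes> g')"
      using 3(4,5) by (simp_all add: X Y Z)
    have "hopf_morphism C H H'' (f' \<cdot> f)" "hopf_morphism C B B'' (g' \<cdot> g)"
      using mor hopf hopf_morphism_Comp by blast+
    moreover have "(g' \<cdot> g) \<cdot> \<phi> = \<phi>'' \<cdot> ((f' \<cdot> f) \<otimes> (g' \<cdot> g))"
      by (rule equivariant_Comp[OF eqs \<phi> mor(1,3,2,4)[THEN hopf_morphism_typing]])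
    ultimately show ?case
      by (simp only: X Z hopf_bracoid_morphism.simps)
  qed
  ultimately show ?thesis by simp
qed

end

section \<open>The functor from 1-cocycles to Hopf bracoids\<close>

theorem theorem3p3:
  fixes C :: "('o, 'm) braided_category"
  assumes "strict_braided_monoidal_category C"
  shows "\<exists>Fo Fa. cat_functor (OneC C) (HBrcd C) Fo Fa \<and>
     (\<forall>H B \<gamma> \<pi>. (H, B, \<gamma>, \<pi>) \<in> Ob (OneC C) \<longrightarrow>
        Fo (H, B, \<gamma>, \<pi>) =
          (H, B, mult B \<cdot>\<^bsub>C\<^esub> (\<pi> \<otimes>\<^bsub>C\<^esub> \<gamma>) \<cdot>\<^bsub>C\<^esub> (comult H \<otimes>\<^bsub>C\<^esub> \<one>\<^bsub>C\<^esub> (car B)))) \<and>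
     (\<forall>X f g Y. (X, (f, g), Y) \<in> Ar (OneC C) \<longrightarrow>
        Fa (X, (f, g), Y) = (Fo X, (f, g), Fo Y))"
proof -
  interpret strict_braided_monoidal_category C by fact
  define Fo where "Fo = (\<lambda>(H :: ('o, 'm) hopf, B :: ('o, 'm) hopf, \<gamma>, \<pi>).
    (H, B, mult B \<cdot>\<^bsub>C\<^esub> (\<pi> \<otimes>\<^bsub>C\<^esub> \<gamma>) \<cdot>\<^bsub>C\<^esub> (comult H \<otimes>\<^bsub>C\<^esub> \<one>\<^bsub>C\<^esub> (car B))))"
  \<comment> \<open>Arrows carry their ends as tags, so being the identity on morphisms means
    keeping the pair and applying \<open>Fo\<close> to both tags.\<close>
  define Fa where "Fa = (\<lambda>(X, p :: 'm \<times> 'm, Y). (Fo X, p, Fo Y))"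
  have Fo: "hopf_bracoid C (Fo X)" if "one_cocycle C X" for X
  proof -
    obtain H B \<gamma> \<pi> where X: "X = (H, B, \<gamma>, \<pi>)" by (cases X)
    interpret cocycle C H B \<gamma> \<pi> by unfold_locales (use that X in simp)
    show ?thesis
      using hopf_bracoid_\<psi> by (simp only: X Fo_def \<psi>_def prod.case)
  qed
  have Fa: "hopf_bracoid_morphism C (Fo X) (Fo Y) p"
    if "one_cocycle C X" "one_cocycle C Y" "one_cocycle_morphism C X Y p" for X Y p
    using that hopf_bracoid_morphism_of_cocycle_morphism
    by (cases X, cases Y, cases p) (simp only: Fo_def prod.case)
  interpret S: category "OneC C" by (rule category_OneC)
  interpret T: category "HBrcd C" by (rule category_HBrcd)
  have "cat_functor (OneC C) (HBrcd C) Fo Fa"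
  proof
    show "Fo X \<in> Ob (HBrcd C)" if "X \<in> Ob (OneC C)" for X
      using that Fo by (simp add: OneC_def HBrcd_def)
    show "Fa F \<in> Hom (HBrcd C) (Fo X) (Fo Y)" if "F \<in> Hom (OneC C) X Y" for F X Y
      using that Fo Fa by (auto simp: OneC_def HBrcd_def Hom_def Fa_def)
    \<comment> \<open>\<open>Fo\<close> keeps both Hopf algebras, hence the identity pair is the
      same on either side.\<close>
    show "Fa (Id (OneC C) X) = Id (HBrcd C) (Fo X)" if "X \<in> Ob (OneC C)" for X
      by (cases X) (simp add: OneC_def HBrcd_def Fa_def Fo_def)
    show "Fa (Comp (OneC C) G F) = Comp (HBrcd C) (Fa G) (Fa F)"
      if "F \<in> Hom (OneC C) X Y" "G \<in> Hom (OneC C) Y Z" for F G X Y Z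
      by (cases F, cases G) (auto simp: OneC_def HBrcd_def Fa_def)
  qed
  then show ?thesis
    by (intro exI[of _ Fo] exI[of _ Fa]) (simp add: Fo_def Fa_def)
qed

end
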